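(* Let $F$ be a linearly differentially closed differential field of characteristic zero whose field of constants $C$ is algebraically closed and satisfies $C\neq F$. Let $\theta:F(\partial)\to M_C(F)$ be the embedding extending the natural action of differential operators on $F$, and let $\pi:\mathrm{End}_C(F)\to M_C(F)$ be the quotient map. Consider $F(\partial)$ as a Lie algebra over $C$ under the commutator bracket. For a $C$-linear map $\alpha:F(\partial)\to \mathrm{End}_C(F)$ with $\pi\alpha=\theta$, define $$\sigma_\alpha(P,Q)=\mathrm{tr}\bigl(\alpha([P,Q])-[\alpha(P),\alpha(Q)]\bigr),\qquad P,Q\in F(\partial).$$ Then: (a) $\sigma_\alpha$ is a Lie algebra 2-cocycle on $F(\partial)$ (with values in the trivial module $C$). (b) The class $[\sigma_\alpha]\in H^2_{Lie}(F(\partial))$ does not depend on the choice of $\alpha$.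
   Context: A differential field is a (commutative) field $F$ with a derivation $a\mapsto a'$; its field of constants is $C=\{a\in F: a'=0\}$. The ring of differential operators $F\langle\partial\rangle$ is the ring generated by $F$ and a symbol $\partial$ subject to $\partial a-a\partial=a'$ for all $a\in F$. Every nonzero $P\in F\langle\partial\rangle$ is uniquely $P=a_0+a_1\partial+\cdots+a_n\partial^n$ with $a_i\in F$, $a_n\ne 0$; $n=\deg(P)$. $P$ acts on $F$ by $P(a)=a_0a+a_1a'+\cdots+a_na^{(n)}$. The ring $F\langle\partial\rangle$ is an Ore domain, and $F(\partial)$ denotes its (noncommutative) field of quotients. $F$ is called linearly differentially closed if every $P\in F\langle\partial\rangle$ with $\deg(P)\ge 1$ has a nonzero solution $a\in F$ of $P(a)=0$; for such fields the following properties are taken as part of the setting: every differential operator is a product of operators of degree at most one, every nonzero differential operator $P:F\to F$ is onto, and $\dim_C\{a\in F:P(a)=0\}=\deg(P)$ for every nonzero $P$. $\mathrm{End}_C(F)$ is the ring of $C$-linear maps $F\to F$, $I(F)$ is the two-sided ideal of maps with finite-dimensional image, and the Calkin algebra is $M_C(F)=\mathrm{End}_C(F)/I(F)$. The homomorphism $\theta:F\langle\partial\rangle\to M_C(F)$ sending $P$ to the class of $a\mapsto P(a)$ extends to an embedding of rings $\theta:F(\partial)\to M_C(F)$. $\mathrm{tr}:I(F)\to C$ is the usual trace of finite-rank maps (it vanishes on commutators of elements of $I(F)$); since $\pi\alpha=\theta$ is a ring homomorphism, $\alpha([P,Q])-[\alpha(P),\alpha(Q)]\in I(F)$. Here $[X,Y]=XY-YX$,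 and $H^2_{Lie}(F(\partial))$ is Lie algebra cohomology over $C$ with trivial coefficients $C$. *)

theory Defs
  imports "HOL-Computational_Algebra.Polynomial"
begin

section \<open>Differential fields and their constants\<close>

class differential_field = field +
  fixes deriv :: "'a \<Rightarrow> 'a"
  assumes deriv_add: "deriv (a + b) = deriv a + deriv b"
    and deriv_mult: "deriv (a * b) = deriv a * b + a * deriv b"
begin

lemma deriv_0 [simp]: "deriv 0 = 0"
  using deriv_add[of 0 0] by simp

lemma deriv_1 [simp]: "deriv 1 = 0"
  using deriv_mult[of 1 1] by simp

lemma deriv_minus: "deriv (- a) = - deriv a"
  using deriv_add[of a "- a"] by (simp add: eq_neg_iff_add_eq_0 add.commute)

lemma deriv_inverse_const:
  assumes "deriv a = 0" shows "deriv (inverse a) = 0"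
proof (cases "a = 0")
  case False
  then have "0 = deriv (a * inverse a)" by simp
  then have "a * deriv (inverse a) = 0" using assms by (simp add: deriv_mult)
  with False show ?thesis by simp
qed simp

end

typedef (overloaded) 'a constants = "{a :: 'a :: differential_field. deriv a = 0}"
  morphisms of_const Const
  by (rule exI[of _ 0]) simp

setup_lifting type_definition_constants

instantiation constants :: (differential_field) field
begin

lift_definition zero_constants :: "'a constants" is 0 by simp
lift_definition one_constants :: "'a constants" is 1 by simp
lift_definition plus_constants :: "'a constants \<Rightarrow> 'a constants \<Rightarrow> 'a constants" is "(+)"
  by (simp add: deriv_add)
lift_definition uminus_constants :: "'a constants \<Rightarrow> 'a constants" is uminus
  by (simp add: deriv_minus)
lift_definition minus_constants :: "'a constants \<Rightarrow> 'a constants \<Rightarrow> 'a constants" is "(-)"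
  by (metis add_0 add_uminus_conv_diff deriv_add deriv_minus minus_zero)
lift_definition times_constants :: "'a constants \<Rightarrow> 'a constants \<Rightarrow> 'a constants" is "(*)"
  by (simp add: deriv_mult)
lift_definition inverse_constants :: "'a constants \<Rightarrow> 'a constants" is inverse
  by (rule deriv_inverse_const)
lift_definition divide_constants :: "'a constants \<Rightarrow> 'a constants \<Rightarrow> 'a constants" is "(/)"
  by (simp add: divide_inverse deriv_mult deriv_inverse_const)

instance
  by standard (transfer; simp add: algebra_simps divide_inverse)+

end

definition cscale :: "'a::differential_field constants \<Rightarrow> 'a \<Rightarrow> 'a" where
  "cscale c a = of_const c * a"

global_interpretation const: vector_space cscale
  by standard (simp_all add: cscale_def algebra_simps
      plus_constants.rep_eq times_constants.rep_eq one_constants.rep_eq)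


section \<open>The ring of differential operators\<close>

text \<open>
  The operator \<open>a\<^sub>0 + a\<^sub>1 \<partial> + \<dots> + a\<^sub>n \<partial>\<^sup>n\<close> is represented by the polynomial with
  coefficients \<open>a\<^sub>i\<close>. Left multiplication by \<open>\<partial>\<close> is determined by \<open>\<partial> a = a \<partial> + a'\<close>.
\<close>

definition left_D :: "'a::differential_field poly \<Rightarrow> 'a poly" where
  "left_D P = map_poly deriv P + pCons 0 P"

definition skew_mult :: "'a::differential_field poly \<Rightarrow> 'a poly \<Rightarrow> 'a poly" where
  "skew_mult P Q = (\<Sum>i\<le>degree P. smult (coeff P i) ((left_D ^^ i) Q))"

lemma coeff_map_deriv [simp]: "coeff (map_poly deriv P) i = deriv (coeff P i)"
  by (rule coeff_map_poly) simp

lemma left_D_add: "left_D (P + Q) = left_D P + left_D Q"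
  by (rule poly_eqI) (simp add: left_D_def deriv_add coeff_pCons split: nat.split)

lemma left_D_0 [simp]: "left_D 0 = 0"
  by (simp add: left_D_def)

lemma left_D_smult: "left_D (smult a P) = smult (deriv a) P + smult a (left_D P)"
  by (rule poly_eqI) (simp add: left_D_def deriv_mult coeff_pCons algebra_simps split: nat.split)

lemma left_D_pow_0 [simp]: "(left_D ^^ i) 0 = 0"
  by (induction i) auto

lemma left_D_pow_add: "(left_D ^^ i) (P + Q) = (left_D ^^ i) P + (left_D ^^ i) Q"
  by (induction i) (auto simp: left_D_add)

lemma skew_mult_conv:
  assumes "degree P \<le> N"
  shows "skew_mult P Q = (\<Sum>i\<le>N. smult (coeff P i) ((left_D ^^ i) Q))"
  unfolding skew_mult_def
  by (rule sum.mono_neutral_left) (use assms in \<open>auto simp: coeff_eq_0\<close>)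

lemma skew_mult_0_left [simp]: "skew_mult 0 Q = 0"
  by (simp add: skew_mult_def)

lemma skew_mult_0_right [simp]: "skew_mult P 0 = 0"
  by (simp add: skew_mult_def)

lemma skew_mult_pCons: "skew_mult (pCons a P) Q = smult a Q + skew_mult P (left_D Q)"
proof -
  have "degree (pCons a P) \<le> Suc (degree P)" by (rule degree_pCons_le)
  from skew_mult_conv[OF this] show ?thesis
    by (simp add: sum.atMost_Suc_shift skew_mult_def funpow_swap1 del: sum.atMost_Suc)
qed

lemma skew_mult_add_left: "skew_mult (P + Q) R = skew_mult P R + skew_mult Q R"
proof -
  let ?N = "max (degree P) (degree Q)"
  have "degree (P + Q) \<le> ?N" by (rule degree_add_le_max)
  then show ?thesis
    by (simp add: skew_mult_conv[where N = ?N] smult_add_left sum.distrib)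
qed

lemma skew_mult_add_right: "skew_mult P (Q + R) = skew_mult P Q + skew_mult P R"
  by (simp add: skew_mult_def left_D_pow_add smult_add_right sum.distrib)

lemma skew_mult_smult_left: "skew_mult (smult a P) Q = smult a (skew_mult P Q)"
proof -
  have "degree (smult a P) \<le> degree P" by (rule degree_smult_le)
  from skew_mult_conv[OF this] show ?thesis
    by (auto intro!: poly_eqI simp: skew_mult_def coeff_sum sum_distrib_left mult.assoc)
qed

lemma left_D_pCons: "left_D (pCons a P) = pCons (deriv a) (left_D P + [:a:])"
  by (rule poly_eqI) (simp add: left_D_def coeff_pCons split: nat.split)

lemma left_D_skew_mult: "left_D (skew_mult P Q) = skew_mult (left_D P) Q"
proof (induction P arbitrary: Q)
  case (pCons a P)
  then show ?case
    by (simp add: skew_mult_pCons left_D_pCons left_D_add left_D_smult skew_mult_add_left add_ac)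
qed simp

lemma skew_mult_assoc: "skew_mult (skew_mult P Q) R = skew_mult P (skew_mult Q R)"
proof (induction P arbitrary: Q)
  case (pCons a P)
  then show ?case
    by (simp add: skew_mult_pCons skew_mult_add_left skew_mult_smult_left left_D_skew_mult)
qed simp

lemma skew_mult_1_left: "skew_mult [:1:] Q = Q"
  by (simp add: skew_mult_pCons)

lemma left_D_pow_1: "(left_D ^^ i) [:1:] = monom 1 i"
  by (induction i) (auto simp: left_D_def monom_Suc map_poly_monom)

lemma skew_mult_1_right: "skew_mult P [:1:] = P"
  by (simp add: skew_mult_def left_D_pow_1 smult_monom poly_as_sum_of_monoms)

typedef (overloaded) 'a diffop = "UNIV :: 'a::differential_field poly set"
  morphisms poly_of_diffop Diffop ..

setup_lifting type_definition_diffop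

instantiation diffop :: (differential_field) ring_1
begin

lift_definition zero_diffop :: "'a diffop" is 0 .
lift_definition one_diffop :: "'a diffop" is "[:1:]" .
lift_definition plus_diffop :: "'a diffop \<Rightarrow> 'a diffop \<Rightarrow> 'a diffop" is "(+)" .
lift_definition uminus_diffop :: "'a diffop \<Rightarrow> 'a diffop" is uminus .
lift_definition minus_diffop :: "'a diffop \<Rightarrow> 'a diffop \<Rightarrow> 'a diffop" is "(-)" .
lift_definition times_diffop :: "'a diffop \<Rightarrow> 'a diffop \<Rightarrow> 'a diffop" is skew_mult .

instance
  by standard
    (transfer; simp add: skew_mult_assoc skew_mult_add_left skew_mult_add_right
      skew_mult_1_left skew_mult_1_right)+

end

lift_definition dcoeff :: "'a::differential_field diffop \<Rightarrow> nat \<Rightarrow> 'a" is coeff .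
lift_definition ddegree :: "'a::differential_field diffop \<Rightarrow> nat" is degree .
lift_definition dconst :: "'a::differential_field \<Rightarrow> 'a diffop" is "\<lambda>a. [:a:]" .
lift_definition dpartial :: "'a::differential_field diffop" is "[:0, 1:]" .

lemma dpartial_commutation: "dpartial * dconst a - dconst a * dpartial = dconst (deriv a)"
  by transfer (simp add: skew_mult_pCons left_D_pCons)

lemma dconst_add: "dconst (a + b) = dconst a + dconst b"
  and dconst_mult: "dconst (a * b) = dconst a * dconst b"
  and dconst_1: "dconst 1 = 1"
  and dconst_0: "dconst 0 = 0"
  by (transfer; simp add: skew_mult_pCons)+

lemma diffop_normal_form: "P = (\<Sum>i\<le>ddegree P. dconst (dcoeff P i) * dpartial ^ i)"
proof -
  have sum: "poly_of_diffop (sum f A) = (\<Sum>i\<in>A. poly_of_diffop (f i))" if "finite A"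
    for f :: "nat \<Rightarrow> 'a diffop" and A
    using that by (induction A rule: finite_induct)
      (auto simp: zero_diffop.rep_eq plus_diffop.rep_eq)
  have pow: "poly_of_diffop (dpartial ^ i :: 'a diffop) = monom 1 i" for i
    by (induction i) (auto simp: one_diffop.rep_eq times_diffop.rep_eq dpartial.rep_eq skew_mult_pCons
        left_D_def map_poly_monom monom_Suc)
  have "poly_of_diffop P
      = poly_of_diffop (\<Sum>i\<le>ddegree P. dconst (dcoeff P i) * dpartial ^ i)"
    by (simp add: sum pow times_diffop.rep_eq dconst.rep_eq dcoeff.rep_eq ddegree.rep_eq
        skew_mult_pCons smult_monom poly_as_sum_of_monoms)
  then show ?thesis by (simp add: poly_of_diffop_inject)
qed

definition diffop_apply :: "'a::differential_field diffop \<Rightarrow> 'a \<Rightarrow> 'a" where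
  "diffop_apply P a = (\<Sum>i\<le>ddegree P. dcoeff P i * (deriv ^^ i) a)"

definition linearly_differentially_closed :: "'a::differential_field itself \<Rightarrow> bool" where
  "linearly_differentially_closed _ \<longleftrightarrow>
    (\<forall>P :: 'a diffop. ddegree P \<ge> 1 \<longrightarrow> (\<exists>a. a \<noteq> 0 \<and> diffop_apply P a = 0))"


section \<open>The algebra of linear maps, the trace and the Calkin algebra\<close>

typedef (overloaded) 'a endo =
    "{f :: 'a::differential_field \<Rightarrow> 'a. Vector_Spaces.linear cscale cscale f}"
  morphisms endo_apply Endo
  by (rule exI[of _ id]) (simp add: const.linear_id)

setup_lifting type_definition_endo

lemma linear_cscale_iff:
  "Vector_Spaces.linear cscale cscale f \<longleftrightarrow>
    (\<forall>x y. f (x + y) = f x + f y) \<and> (\<forall>c x. f (cscale c x) = cscale c (f x))"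
  by (auto simp: Vector_Spaces.linear_iff const.vector_space_axioms)

instantiation endo :: (differential_field) ring_1
begin

lift_definition zero_endo :: "'a endo" is "\<lambda>_. 0" 
  by (simp add: linear_cscale_iff)
lift_definition one_endo :: "'a endo" is "\<lambda>x. x" 
  by (simp add: linear_cscale_iff)
lift_definition plus_endo :: "'a endo \<Rightarrow> 'a endo \<Rightarrow> 'a endo" is "\<lambda>f g x. f x + g x"
  by (simp add: linear_cscale_iff const.scale_right_distrib add_ac)
lift_definition uminus_endo :: "'a endo \<Rightarrow> 'a endo" is "\<lambda>f x. - f x"
  by (simp add: linear_cscale_iff)
lift_definition minus_endo :: "'a endo \<Rightarrow> 'a endo \<Rightarrow> 'a endo" is "\<lambda>f g x. f x - g x"
  by (simp add: linear_cscale_iff const.scale_right_diff_distrib)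
lift_definition times_endo :: "'a endo \<Rightarrow> 'a endo \<Rightarrow> 'a endo" is "\<lambda>f g x. f (g x)"
  by (simp add: linear_cscale_iff)

instance
proof
  show "(0 :: 'a endo) \<noteq> 1"
    by transfer (metis zero_neq_one)
qed (transfer; simp add: linear_cscale_iff fun_eq_iff)+

end

lift_definition escale :: "'a::differential_field constants \<Rightarrow> 'a endo \<Rightarrow> 'a endo"
  is "\<lambda>c f x. cscale c (f x)"
  by (simp add: linear_cscale_iff const.scale_right_distrib const.scale_left_commute)

global_interpretation endo: vector_space escale
  by standard (transfer; simp add: fun_eq_iff const.scale_right_distrib const.scale_left_distrib)+

definition finite_rank :: "'a::differential_field endo \<Rightarrow> bool" where
  "finite_rank f \<longleftrightarrow> (\<exists>B. finite B \<and> range (endo_apply f) \<subseteq> const.span B)"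

text \<open>
  The trace of the restriction of \<open>f\<close> to its range, computed in a basis of the range. It is
  meaningful only if the range is finite-dimensional.
\<close>

definition trace :: "'a::differential_field endo \<Rightarrow> 'a constants" where
  "trace f =
    (let B = (SOME B. const.independent B \<and> const.span B = range (endo_apply f))
     in \<Sum>b\<in>B. const.representation B (endo_apply f b) b)"

lemma finite_rank_0 [simp]: "finite_rank 0"
  unfolding finite_rank_def by (rule exI[of _ "{}"]) (auto simp: zero_endo.rep_eq)

lemma finite_rank_uminus:
  assumes "finite_rank f" shows "finite_rank (- f)"
proof -
  from assms obtain B where "finite B" "range (endo_apply f) \<subseteq> const.span B"
    unfolding finite_rank_def by blast
  then show ?thesis
    unfolding finite_rank_def
    by (intro exI[of _ B]) (auto simp: uminus_endo.rep_eq intro!: const.span_neg)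
qed

lemma finite_rank_add:
  assumes "finite_rank f" "finite_rank g" shows "finite_rank (f + g)"
proof -
  from assms obtain A B where "finite A" "range (endo_apply f) \<subseteq> const.span A"
    "finite B" "range (endo_apply g) \<subseteq> const.span B"
    unfolding finite_rank_def by blast
  moreover have "const.span A \<subseteq> const.span (A \<union> B)" "const.span B \<subseteq> const.span (A \<union> B)"
    by (auto intro!: const.span_mono)
  ultimately show ?thesis
    unfolding finite_rank_def
    by (intro exI[of _ "A \<union> B"]) (auto simp: plus_endo.rep_eq intro!: const.span_add)
qed

lemma finite_rank_mult_right:
  assumes "finite_rank f" shows "finite_rank (f * g)"
  using assms unfolding finite_rank_def times_endo.rep_eq by blast

lemma finite_rank_mult_left:
  assumes "finite_rank f" shows "finite_rank (g * f)"
proof -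
  from assms obtain B where B: "finite B" "range (endo_apply f) \<subseteq> const.span B"
    unfolding finite_rank_def by blast
  have lin: "module_hom cscale cscale (endo_apply g)"
    using endo_apply[of g] by (simp add: linear_iff_module_hom)
  have "range (endo_apply (g * f)) \<subseteq> endo_apply g ` const.span B"
    using B(2) by (auto simp: times_endo.rep_eq)
  also have "\<dots> = const.span (endo_apply g ` B)"
    by (rule module_hom.span_image[OF lin, symmetric])
  finally show ?thesis
    unfolding finite_rank_def using B(1) by blast
qed

definition calkin_rel :: "'a::differential_field endo \<Rightarrow> 'a endo \<Rightarrow> bool" where
  "calkin_rel f g \<longleftrightarrow> finite_rank (f - g)"

lemma calkin_rel_plus:
  assumes "calkin_rel f f'" "calkin_rel g g'" shows "calkin_rel (f + g) (f' + g')"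
  using finite_rank_add[OF assms[unfolded calkin_rel_def]]
  by (simp add: calkin_rel_def algebra_simps)

lemma calkin_rel_uminus:
  assumes "calkin_rel f f'" shows "calkin_rel (- f) (- f')"
  using finite_rank_uminus[OF assms[unfolded calkin_rel_def]]
  by (simp add: calkin_rel_def)

lemma calkin_rel_times:
  assumes "calkin_rel f f'" "calkin_rel g g'" shows "calkin_rel (f * g) (f' * g')"
proof -
  have "finite_rank ((f - f') * g + f' * (g - g'))"
    using assms unfolding calkin_rel_def
    by (intro finite_rank_add finite_rank_mult_left finite_rank_mult_right)
  then show ?thesis by (simp add: calkin_rel_def algebra_simps)
qed

quotient_type (overloaded) 'a calkin = "'a::differential_field endo" / calkin_rel
  morphisms rep_calkin calkin_proj
proof (rule equivpI)
  show "reflp (calkin_rel :: 'a endo \<Rightarrow> _)"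
    by (simp add: reflp_def calkin_rel_def)
  show "symp (calkin_rel :: 'a endo \<Rightarrow> _)"
    unfolding symp_def calkin_rel_def by (metis finite_rank_uminus minus_diff_eq)
  show "transp (calkin_rel :: 'a endo \<Rightarrow> _)"
    unfolding transp_def calkin_rel_def
    by (metis add.commute add_diff_eq diff_add_cancel finite_rank_add)
qed

text \<open>
  No \<open>ring_1\<close> instance: if \<open>F\<close> has finite dimension over its constants, the Calkin algebra is
  the zero ring.
\<close>

instantiation calkin :: (differential_field) "{ring, monoid_mult}"
begin

lift_definition zero_calkin :: "'a calkin" is 0 .
lift_definition one_calkin :: "'a calkin" is 1 .
lift_definition plus_calkin :: "'a calkin \<Rightarrow> 'a calkin \<Rightarrow> 'a calkin" is "(+)"
  by (rule calkin_rel_plus)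
lift_definition uminus_calkin :: "'a calkin \<Rightarrow> 'a calkin" is uminus
  by (rule calkin_rel_uminus)
lift_definition minus_calkin :: "'a calkin \<Rightarrow> 'a calkin \<Rightarrow> 'a calkin" is "(-)"
  using calkin_rel_plus[OF _ calkin_rel_uminus] by fastforce
lift_definition times_calkin :: "'a calkin \<Rightarrow> 'a calkin \<Rightarrow> 'a calkin" is "(*)"
  by (rule calkin_rel_times)

instance
  by standard (transfer; simp add: calkin_rel_def algebra_simps)+

end

lemma cscale_deriv: "deriv (cscale c a) = cscale c (deriv a)"
  using of_const[of c] by (simp add: cscale_def deriv_mult)

lift_definition diffop_endo :: "'a::differential_field diffop \<Rightarrow> 'a endo" is diffop_apply
proof -
  fix P :: "'a diffop"
  have add: "(deriv ^^ i) (x + y) = (deriv ^^ i) x + (deriv ^^ i) y" for i and x y :: 'a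
    by (induction i) (auto simp: deriv_add)
  have scale: "(deriv ^^ i) (cscale c x) = cscale c ((deriv ^^ i) x)" for i c and x :: 'a
    by (induction i) (auto simp: cscale_deriv)
  show "Vector_Spaces.linear cscale cscale (diffop_apply P)"
    unfolding linear_cscale_iff diffop_apply_def add scale
    by (simp add: cscale_def algebra_simps sum.distrib sum_distrib_left)
qed


section \<open>Fields of quotients\<close>

definition ring_embedding :: "('r::{ring, monoid_mult} \<Rightarrow> 's::{ring, monoid_mult}) \<Rightarrow> bool" where
  "ring_embedding f \<longleftrightarrow> inj f \<and> f 1 = 1 \<and>
    (\<forall>x y. f (x + y) = f x + f y) \<and> (\<forall>x y. f (x * y) = f x * f y)"

text \<open>
  \<open>K\<close> together with \<open>\<iota> : R \<rightarrow> K\<close> is a field of quotients of the Ore domain \<open>R\<close>. This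
  determines \<open>(K, \<iota>)\<close> up to unique isomorphism.
\<close>

definition field_of_quotients :: "('r::ring_1 \<Rightarrow> 'k::division_ring) \<Rightarrow> bool" where
  "field_of_quotients \<iota> \<longleftrightarrow> ring_embedding \<iota> \<and>
    (\<forall>x. \<exists>P Q. Q \<noteq> 0 \<and> x = \<iota> P * inverse (\<iota> Q)) \<and>
    (\<forall>x. \<exists>P Q. Q \<noteq> 0 \<and> x = inverse (\<iota> Q) * \<iota> P)"

definition qscale ::
    "('a::differential_field diffop \<Rightarrow> 'k::division_ring) \<Rightarrow> 'a constants \<Rightarrow> 'k \<Rightarrow> 'k" where
  "qscale \<iota> c x = \<iota> (dconst (of_const c)) * x"

lemma vector_space_qscale:
  assumes "ring_embedding \<iota>" shows "vector_space (qscale \<iota>)"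
  by standard (use assms in \<open>simp_all add: qscale_def ring_embedding_def algebra_simps dconst_add
      dconst_mult dconst_1 plus_constants.rep_eq times_constants.rep_eq one_constants.rep_eq\<close>)


section \<open>Lie algebra cohomology in degree two\<close>

definition commutator :: "'r::ring \<Rightarrow> 'r \<Rightarrow> 'r" where
  "commutator x y = x * y - y * x"

text \<open>
  Chevalley--Eilenberg cochains of a Lie algebra with scalar multiplication \<open>s\<close> and bracket
  \<open>br\<close>, with values in the trivial module given by the ground field.
\<close>

definition cochains1 :: "('c::field \<Rightarrow> 'l::ab_group_add \<Rightarrow> 'l) \<Rightarrow> ('l \<Rightarrow> 'c) set" where
  "cochains1 s = {f. Vector_Spaces.linear s (*) f}"

definition cochains2 :: "('c::field \<Rightarrow> 'l::ab_group_add \<Rightarrow> 'l) \<Rightarrow> ('l \<Rightarrow> 'l \<Rightarrow> 'c) set" where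
  "cochains2 s = {\<sigma>. (\<forall>x. Vector_Spaces.linear s (*) (\<lambda>y. \<sigma> x y)) \<and>
    (\<forall>y. Vector_Spaces.linear s (*) (\<lambda>x. \<sigma> x y)) \<and> (\<forall>x. \<sigma> x x = 0)}"

definition differential1 :: "('l \<Rightarrow> 'l \<Rightarrow> 'l) \<Rightarrow> ('l \<Rightarrow> 'c::field) \<Rightarrow> 'l \<Rightarrow> 'l \<Rightarrow> 'c" where
  "differential1 br f x y = - f (br x y)"

definition differential2 ::
    "('l \<Rightarrow> 'l \<Rightarrow> 'l) \<Rightarrow> ('l \<Rightarrow> 'l \<Rightarrow> 'c::field) \<Rightarrow> 'l \<Rightarrow> 'l \<Rightarrow> 'l \<Rightarrow> 'c" where
  "differential2 br \<sigma> x y z = - \<sigma> (br x y) z + \<sigma> (br x z) y - \<sigma> (br y z) x"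

definition cocycles2 ::
    "('c::field \<Rightarrow> 'l::ab_group_add \<Rightarrow> 'l) \<Rightarrow> ('l \<Rightarrow> 'l \<Rightarrow> 'l) \<Rightarrow> ('l \<Rightarrow> 'l \<Rightarrow> 'c) set" where
  "cocycles2 s br = {\<sigma> \<in> cochains2 s. \<forall>x y z. differential2 br \<sigma> x y z = 0}"

definition coboundaries2 ::
    "('c::field \<Rightarrow> 'l::ab_group_add \<Rightarrow> 'l) \<Rightarrow> ('l \<Rightarrow> 'l \<Rightarrow> 'l) \<Rightarrow> ('l \<Rightarrow> 'l \<Rightarrow> 'c) set" where
  "coboundaries2 s br = differential1 br ` cochains1 s"

definition cohomologous2 ::
    "('c::field \<Rightarrow> 'l::ab_group_add \<Rightarrow> 'l) \<Rightarrow> ('l \<Rightarrow> 'l \<Rightarrow> 'l) \<Rightarrow>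
      (('l \<Rightarrow> 'l \<Rightarrow> 'c) \<times> ('l \<Rightarrow> 'l \<Rightarrow> 'c)) set" where
  "cohomologous2 s br = {(\<sigma>, \<tau>). \<sigma> \<in> cocycles2 s br \<and> \<tau> \<in> cocycles2 s br \<and>
    (\<lambda>x y. \<sigma> x y - \<tau> x y) \<in> coboundaries2 s br}"

definition H2_Lie ::
    "('c::field \<Rightarrow> 'l::ab_group_add \<Rightarrow> 'l) \<Rightarrow> ('l \<Rightarrow> 'l \<Rightarrow> 'l) \<Rightarrow> ('l \<Rightarrow> 'l \<Rightarrow> 'c) set set" where
  "H2_Lie s br = cocycles2 s br // cohomologous2 s br"

definition H2_class ::
    "('c::field \<Rightarrow> 'l::ab_group_add \<Rightarrow> 'l) \<Rightarrow> ('l \<Rightarrow> 'l \<Rightarrow> 'l) \<Rightarrow>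
      ('l \<Rightarrow> 'l \<Rightarrow> 'c) \<Rightarrow> ('l \<Rightarrow> 'l \<Rightarrow> 'c) set" where
  "H2_class s br \<sigma> = cohomologous2 s br `` {\<sigma>}"


section \<open>The cochain of a linear lift\<close>

definition linear_lift ::
    "('a::differential_field diffop \<Rightarrow> 'k::division_ring) \<Rightarrow> ('k \<Rightarrow> 'a calkin) \<Rightarrow>
      ('k \<Rightarrow> 'a endo) \<Rightarrow> bool" where
  "linear_lift \<iota> \<theta> \<alpha> \<longleftrightarrow>
    Vector_Spaces.linear (qscale \<iota>) escale \<alpha> \<and> (\<forall>P. calkin_proj (\<alpha> P) = \<theta> P)"

definition sigma :: "('k::division_ring \<Rightarrow> 'a::differential_field endo) \<Rightarrow> 'k \<Rightarrow> 'k \<Rightarrow> 'a constants"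
  where "sigma \<alpha> P Q = trace (\<alpha> (commutator P Q) - commutator (\<alpha> P) (\<alpha> Q))"

end

theory Submission
  imports Defs
begin

text \<open>
  Let \<open>\<omega>(P, Q) = \<alpha>([P, Q]) - [\<alpha>(P), \<alpha>(Q)]\<close> be the defect of a lift \<open>\<alpha>\<close>, a map of finite
  rank. Everything follows from one property of the trace: \<open>tr [f, g] = 0\<close> as soon as one of
  the two maps \<open>f\<close>, \<open>g\<close> has finite rank, while the other one is arbitrary
  (\<open>trace_commutator_left\<close>). The case where both have finite rank would not be enough,
  because \<open>[\<omega>(x, y), \<alpha> z]\<close> occurs below and \<open>\<alpha> z\<close> need not have finite rank.

  For the cocycle identity, \<open>\<omega>([x, y], z) = \<alpha>([[x, y], z]) - [[\<alpha> x, \<alpha> y], \<alpha> z] - [\<omega>(x, y), \<alpha> z]\<close>.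
  In the cyclic sum the first two terms disappear by the Jacobi identities in \<open>F(\<partial>)\<close> and in
  \<open>End\<^sub>C(F)\<close>, and the third one has trace zero. For the independence, two lifts differ by a
  linear map \<open>\<phi>\<close> whose values have finite rank, and
  \<open>\<omega>\<^sub>\<alpha>(x, y) - \<omega>\<^sub>\<beta>(x, y) = \<phi>([x, y]) - [\<phi> x, \<alpha> y] - [\<beta> x, \<phi> y]\<close>;
  taking traces shows that \<open>\<sigma>\<^sub>\<alpha> - \<sigma>\<^sub>\<beta>\<close> is the coboundary of \<open>- tr \<circ> \<phi>\<close>.

  The bracket of \<open>F(\<partial>)\<close> is \<open>C\<close>-bilinear because constants are central in \<open>F\<langle>\<partial>\<rangle>\<close>, hence
  in its field of quotients (\<open>constants_central\<close>).
\<close>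

section \<open>The trace of maps of finite rank\<close>

definition trace_in_basis :: "'a set \<Rightarrow> 'a::differential_field endo \<Rightarrow> 'a constants" where
  "trace_in_basis B f = (\<Sum>b\<in>B. const.representation B (endo_apply f b) b)"

lemma endo_apply_sum_scale:
  "endo_apply f (\<Sum>x\<in>S. cscale (c x) (v x)) = (\<Sum>x\<in>S. cscale (c x) (endo_apply f (v x)))"
proof -
  interpret module_hom cscale cscale "endo_apply f"
    using endo_apply[of f] by (simp add: linear_iff_module_hom)
  show ?thesis by (simp add: sum scale)
qed

lemma representation_sum_scale:
  assumes "const.independent B" and "\<And>x. x \<in> S \<Longrightarrow> v x \<in> const.span B"
  shows "const.representation B (\<Sum>x\<in>S. cscale (c x) (v x)) b =
    (\<Sum>x\<in>S. c x * const.representation B (v x) b)"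
  using assms
  by (simp add: const.representation_sum const.span_scale const.representation_scale)

text \<open>
  With respect to finite bases, \<open>f\<close> and \<open>g\<close> are given by rectangular matrices
  \<open>(f\<^sub>a\<^sub>b)\<close> and \<open>(g\<^sub>b\<^sub>a)\<close>, and both sides are \<open>\<Sum> f\<^sub>a\<^sub>b g\<^sub>b\<^sub>a\<close>. The space is
  infinite-dimensional, so the bases \<open>A\<close> and \<open>B\<close> only span subspaces; it suffices that \<open>f\<close>
  maps everything into the first one and \<open>g\<close> maps the first one into the second one.
\<close>

lemma trace_in_basis_swap:
  assumes A: "finite A" "const.independent A" and B: "finite B" "const.independent B"
    and f: "range (endo_apply f) \<subseteq> const.span A"
    and g: "endo_apply g ` A \<subseteq> const.span B"
  shows "trace_in_basis A (f * g) = trace_in_basis B (g * f)"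
proof -
  let ?RA = "const.representation A" and ?RB = "const.representation B"
  let ?f = "endo_apply f" and ?g = "endo_apply g"
  have fA: "?f x \<in> const.span A" for x using f by auto
  have gB: "?g a \<in> const.span B" if "a \<in> A" for a using g that by auto
  have fg: "?RA (?f (?g a)) a = (\<Sum>b\<in>B. ?RB (?g a) b * ?RA (?f b) a)" if "a \<in> A" for a
  proof -
    have "?g a = (\<Sum>b\<in>B. cscale (?RB (?g a) b) b)"
      using const.sum_representation_eq[OF B(2) gB[OF that] B(1) subset_refl] by simp
    then have "?f (?g a) = (\<Sum>b\<in>B. cscale (?RB (?g a) b) (?f b))"
      using endo_apply_sum_scale[of f "\<lambda>b. ?RB (?g a) b" "\<lambda>b. b" B] by simp
    then show ?thesis
      by (simp add: representation_sum_scale[OF A(2) fA])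
  qed
  have gf: "?RB (?g (?f b)) b = (\<Sum>a\<in>A. ?RA (?f b) a * ?RB (?g a) b)" for b
  proof -
    have "?f b = (\<Sum>a\<in>A. cscale (?RA (?f b) a) a)"
      using const.sum_representation_eq[OF A(2) fA A(1) subset_refl] by simp
    then have "?g (?f b) = (\<Sum>a\<in>A. cscale (?RA (?f b) a) (?g a))"
      using endo_apply_sum_scale[of g "\<lambda>a. ?RA (?f b) a" "\<lambda>a. a" A] by simp
    then show ?thesis
      by (simp add: representation_sum_scale[OF B(2) gB])
  qed
  have "trace_in_basis A (f * g) = (\<Sum>a\<in>A. \<Sum>b\<in>B. ?RB (?g a) b * ?RA (?f b) a)"
    unfolding trace_in_basis_def times_endo.rep_eq by (rule sum.cong) (simp_all add: fg)
  also have "\<dots> = (\<Sum>b\<in>B. \<Sum>a\<in>A. ?RA (?f b) a * ?RB (?g a) b)"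
    by (subst sum.swap) (simp add: mult.commute)
  also have "\<dots> = trace_in_basis B (g * f)"
    unfolding trace_in_basis_def times_endo.rep_eq by (simp add: gf)
  finally show ?thesis .
qed

lemma finite_basis_of_span:
  assumes "finite S"
  obtains B where "finite B" "const.independent B" "S \<subseteq> const.span B"
  using const.maximal_independent_subset[of S] finite_subset[OF _ assms] by metis

lemma finite_rank_basis:
  assumes "finite_rank f"
  obtains B where "finite B" "const.independent B" "range (endo_apply f) \<subseteq> const.span B"
proof -
  from assms obtain S where S: "finite S" "range (endo_apply f) \<subseteq> const.span S"
    unfolding finite_rank_def by blast
  from finite_basis_of_span[OF S(1)] obtain B
    where B: "finite B" "const.independent B" "S \<subseteq> const.span B" .
  have "const.span S \<subseteq> const.span B"
    using B(3) by (simp add: const.span_minimal)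
  with S(2) B(1,2) show ?thesis by (intro that[of B]) auto
qed

lemma subspace_range_endo: "const.subspace (range (endo_apply f))"
proof -
  interpret module_hom cscale cscale "endo_apply f"
    using endo_apply[of f] by (simp add: linear_iff_module_hom)
  show ?thesis by (rule subspace_image) simp
qed

text \<open>
  Passing from one basis to another is the case \<open>g = 1\<close> of \<open>trace_in_basis_swap\<close>. It allows
  the trace to be computed in any sufficiently large subspace, not only in the range, so that
  several maps can be treated in the same basis.
\<close>

lemma trace_eq_trace_in_basis:
  assumes B: "finite B" "const.independent B" and f: "range (endo_apply f) \<subseteq> const.span B"
  shows "trace f = trace_in_basis B f"
proof -
  define A where
    "A = (SOME A. const.independent A \<and> const.span A = range (endo_apply f))"
  have "\<exists>A. const.independent A \<and> const.span A = range (endo_apply f)"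
    using const.basis_exists[of "range (endo_apply f)"] subspace_range_endo[of f]
    by (metis const.span_minimal subset_antisym)
  from someI_ex[OF this] have A: "const.independent A" "const.span A = range (endo_apply f)"
    by (simp_all add: A_def)
  have AB: "A \<subseteq> const.span B"
    using A(2) f const.span_superset[of A] by blast
  then have "finite A"
    using const.independent_span_bound[OF B(1) A(1)] by simp
  have "trace f = trace_in_basis A (f * 1)"
    by (simp add: trace_def trace_in_basis_def A_def)
  also have "\<dots> = trace_in_basis B (1 * f)"
    by (rule trace_in_basis_swap) (use A B AB \<open>finite A\<close> in \<open>auto simp: one_endo.rep_eq\<close>)
  finally show ?thesis by simp
qed

lemma trace_add:
  assumes "finite_rank f" "finite_rank g"
  shows "trace (f + g) = trace f + trace g"
proof -
  from finite_rank_basis[OF assms(1)] obtain S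
    where S: "finite S" "const.independent S" "range (endo_apply f) \<subseteq> const.span S" .
  from finite_rank_basis[OF assms(2)] obtain T
    where T: "finite T" "const.independent T" "range (endo_apply g) \<subseteq> const.span T" .
  have "finite (S \<union> T)" using S T by simp
  from finite_basis_of_span[OF this] obtain B
    where B: "finite B" "const.independent B" "S \<union> T \<subseteq> const.span B" .
  have "const.span S \<subseteq> const.span B" "const.span T \<subseteq> const.span B"
    using B(3) by (simp_all add: const.span_minimal)
  with S(3) T(3) have f: "endo_apply f x \<in> const.span B" and g: "endo_apply g x \<in> const.span B"
    for x by auto
  have "range (endo_apply (f + g)) \<subseteq> const.span B"
    using f g by (auto simp: plus_endo.rep_eq intro: const.span_add)
  with f g show ?thesis
    by (simp add: trace_eq_trace_in_basis[OF B(1,2)] image_subset_iff trace_in_basis_def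
        plus_endo.rep_eq const.representation_add[OF B(2)] sum.distrib)
qed

lemma trace_scale:
  assumes "finite_rank f"
  shows "trace (escale c f) = c * trace f"
proof -
  from finite_rank_basis[OF assms] obtain B
    where B: "finite B" "const.independent B" "range (endo_apply f) \<subseteq> const.span B" .
  then have f: "endo_apply f x \<in> const.span B" for x by auto
  then have "range (endo_apply (escale c f)) \<subseteq> const.span B"
    by (auto simp: escale.rep_eq intro: const.span_scale)
  with f show ?thesis
    by (simp add: trace_eq_trace_in_basis[OF B(1,2)] image_subset_iff trace_in_basis_def
        escale.rep_eq const.representation_scale[OF B(2)] sum_distrib_left)
qed

lemma trace_minus:
  assumes "finite_rank f"
  shows "trace (- f) = - trace f"
  using trace_scale[OF assms, of "- 1"] by simp

lemma finite_rank_diff: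
  assumes "finite_rank f" "finite_rank g"
  shows "finite_rank (f - g)"
  using finite_rank_add[OF assms(1) finite_rank_uminus[OF assms(2)]] by simp

lemma trace_diff:
  assumes "finite_rank f" "finite_rank g"
  shows "trace (f - g) = trace f - trace g"
  using trace_add[OF assms(1) finite_rank_uminus[OF assms(2)]] trace_minus[OF assms(2)] by simp

lemma trace_0: "trace 0 = 0"
  using trace_diff[OF finite_rank_0 finite_rank_0] by simp

text \<open>
  If \<open>A\<close> spans the range of \<open>f\<close>, then \<open>f g\<close> takes values in the span of \<open>A\<close> and \<open>g f\<close> takes
  values in the span of \<open>g(A)\<close>, which is still finite although \<open>g\<close> is arbitrary.
\<close>

lemma trace_mult_commute:
  assumes "finite_rank f"
  shows "trace (f * g) = trace (g * f)"
proof -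
  from finite_rank_basis[OF assms] obtain A
    where A: "finite A" "const.independent A" "range (endo_apply f) \<subseteq> const.span A" .
  from finite_basis_of_span[of "endo_apply g ` A"] A(1) obtain B
    where B: "finite B" "const.independent B" "endo_apply g ` A \<subseteq> const.span B" by blast
  interpret g: module_hom cscale cscale "endo_apply g"
    using endo_apply[of g] by (simp add: linear_iff_module_hom)
  have "endo_apply g ` const.span A \<subseteq> const.span B"
    using B(3) by (metis g.span_image const.span_minimal const.subspace_span)
  then have gf: "range (endo_apply (g * f)) \<subseteq> const.span B"
    using A(3) by (auto simp: times_endo.rep_eq)
  have fg: "range (endo_apply (f * g)) \<subseteq> const.span A"
    using A(3) by (auto simp: times_endo.rep_eq)
  show ?thesis
    unfolding trace_eq_trace_in_basis[OF A(1,2) fg] trace_eq_trace_in_basis[OF B(1,2) gf]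
    by (rule trace_in_basis_swap) (use A B in auto)
qed

lemma finite_rank_commutator_left: "finite_rank f \<Longrightarrow> finite_rank (commutator f g)"
  and finite_rank_commutator_right: "finite_rank f \<Longrightarrow> finite_rank (commutator g f)"
  unfolding commutator_def
  by (intro finite_rank_diff finite_rank_mult_left finite_rank_mult_right; assumption)+

lemma trace_commutator_left: "finite_rank f \<Longrightarrow> trace (commutator f g) = 0"
  and trace_commutator_right: "finite_rank f \<Longrightarrow> trace (commutator g f) = 0"
  using trace_mult_commute[of f g]
  by (simp_all add: commutator_def trace_diff finite_rank_mult_left finite_rank_mult_right)


section \<open>Cohomologous cocycles\<close>

lemma coboundaries2_add:
  assumes "\<sigma> \<in> coboundaries2 s br" "\<tau> \<in> coboundaries2 s br"
  shows "(\<lambda>x y. \<sigma> x y + \<tau> x y) \<in> coboundaries2 s br"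
proof -
  from assms obtain f g where fg: "Vector_Spaces.linear s (*) f" "Vector_Spaces.linear s (*) g"
    and eq: "\<sigma> = differential1 br f" "\<tau> = differential1 br g"
    unfolding coboundaries2_def cochains1_def by blast
  have "Vector_Spaces.linear s (*) (\<lambda>x. f x + g x)"
    using fg by (auto simp: Vector_Spaces.linear_iff algebra_simps)
  then show ?thesis
    unfolding coboundaries2_def cochains1_def
    by (intro image_eqI[of _ _ "\<lambda>x. f x + g x"]) (auto simp: eq differential1_def fun_eq_iff)
qed

lemma coboundaries2_uminus:
  assumes "\<sigma> \<in> coboundaries2 s br"
  shows "(\<lambda>x y. - \<sigma> x y) \<in> coboundaries2 s br"
proof -
  from assms obtain f where f: "Vector_Spaces.linear s (*) f" and eq: "\<sigma> = differential1 br f"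
    unfolding coboundaries2_def cochains1_def by blast
  have "Vector_Spaces.linear s (*) (\<lambda>x. - f x)"
    using f by (auto simp: Vector_Spaces.linear_iff)
  then show ?thesis
    unfolding coboundaries2_def cochains1_def
    by (intro image_eqI[of _ _ "\<lambda>x. - f x"]) (auto simp: eq differential1_def fun_eq_iff)
qed

lemma H2_class_eqI:
  assumes "(\<sigma>, \<tau>) \<in> cohomologous2 s br"
  shows "H2_class s br \<sigma> = H2_class s br \<tau>"
proof -
  have diff: "(\<lambda>x y. \<sigma> x y - \<tau> x y) \<in> coboundaries2 s br"
    and cocycles: "\<sigma> \<in> cocycles2 s br" "\<tau> \<in> cocycles2 s br"
    using assms by (auto simp: cohomologous2_def)
  have "(\<lambda>x y. \<sigma> x y - \<rho> x y) \<in> coboundaries2 s br \<longleftrightarrow>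
      (\<lambda>x y. \<tau> x y - \<rho> x y) \<in> coboundaries2 s br" for \<rho>
    using coboundaries2_add[OF diff, of "\<lambda>x y. \<tau> x y - \<rho> x y"]
      coboundaries2_add[OF coboundaries2_uminus[OF diff], of "\<lambda>x y. \<sigma> x y - \<rho> x y"]
    by auto
  with cocycles show ?thesis
    by (auto simp: H2_class_def cohomologous2_def)
qed


section \<open>The bracket of the field of quotients\<close>

lemma diffop_constants_central:
  assumes "deriv c = 0"
  shows "dconst c * P = P * dconst c"
  using assms
proof (transfer, goal_cases)
  case (1 c P)
  \<comment> \<open>This is \<open>\<partial>\<^sup>i c = c \<partial>\<^sup>i\<close>, since \<open>c' = 0\<close>.\<close>
  have "(left_D ^^ i) [:c:] = monom c i" for i
    using 1 by (induction i) (auto simp: left_D_def monom_Suc map_poly_monom monom_0)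
  then have "skew_mult P [:c:] = (\<Sum>i\<le>degree P. smult c (monom (coeff P i) i))"
    by (simp add: skew_mult_def smult_monom mult.commute)
  also have "\<dots> = smult c (\<Sum>i\<le>degree P. monom (coeff P i) i)"
    by (rule poly_eqI) (simp add: coeff_sum flip: sum_distrib_left)
  also have "\<dots> = skew_mult [:c:] P"
    by (simp add: poly_as_sum_of_monoms skew_mult_pCons)
  finally show ?case by simp
qed

lemma division_ring_inverse_commute:
  fixes a x :: "'k::division_ring"
  assumes "a * x = x * a" shows "a * inverse x = inverse x * a"
proof (cases "x = 0")
  case False
  have "inverse x * (a * x) * inverse x = inverse x * (x * a) * inverse x"
    using assms by simp
  moreover have "inverse x * (x * a) = a"
    using False by (simp flip: mult.assoc)
  ultimately show ?thesis
    using False by (simp add: mult.assoc)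
qed simp

text \<open>An element that commutes with numerator and denominator commutes with the quotient.\<close>

lemma constants_central:
  assumes "field_of_quotients \<iota>" and "deriv c = 0"
  shows "\<iota> (dconst c) * x = x * \<iota> (dconst c)"
proof -
  have mult: "\<iota> (P * Q) = \<iota> P * \<iota> Q" for P Q
    using assms(1) by (auto simp: field_of_quotients_def ring_embedding_def)
  have comm: "\<iota> (dconst c) * \<iota> P = \<iota> P * \<iota> (dconst c)" for P
    by (metis mult diffop_constants_central[OF assms(2)])
  obtain P Q where "x = \<iota> P * inverse (\<iota> Q)"
    using assms(1) unfolding field_of_quotients_def by blast
  then show ?thesis
    using comm[of P] division_ring_inverse_commute[OF comm[of Q]]
    by (metis mult.assoc)
qed

lemma commutator_self: "commutator x x = 0"
  and commutator_add_left: "commutator (x + y) z = commutator x z + commutator y z"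
  and commutator_add_right: "commutator z (x + y) = commutator z x + commutator z y"
  and commutator_diff_left: "commutator (x - y) z = commutator x z - commutator y z"
  and commutator_diff_right: "commutator z (x - y) = commutator z x - commutator z y"
  by (simp_all add: commutator_def algebra_simps)

lemma commutator_jacobi:
  "commutator (commutator x y) z - commutator (commutator x z) y + commutator (commutator y z) x = 0"
  by (simp add: commutator_def algebra_simps)

lemma commutator_qscale:
  assumes "field_of_quotients \<iota>"
  shows "commutator (qscale \<iota> c x) y = qscale \<iota> c (commutator x y)"
    and "commutator x (qscale \<iota> c y) = qscale \<iota> c (commutator x y)"
proof -
  have "deriv (of_const c) = 0" using of_const[of c] by simp
  note central = constants_central[OF assms this]
  show "commutator (qscale \<iota> c x) y = qscale \<iota> c (commutator x y)"
    unfolding commutator_def qscale_def by (simp add: right_diff_distrib central mult.assoc)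
  show "commutator x (qscale \<iota> c y) = qscale \<iota> c (commutator x y)"
    unfolding commutator_def qscale_def by (simp add: right_diff_distrib central mult.assoc)
qed

lemma commutator_escale:
  "commutator (escale c f) g = escale c (commutator f g)"
  "commutator f (escale c g) = escale c (commutator f g)"
proof -
  have "escale c f * g = escale c (f * g)" for f g :: "'a endo"
    by transfer simp
  moreover have "f * escale c g = escale c (f * g)" for f g :: "'a endo"
    by transfer (simp add: linear_cscale_iff)
  ultimately show "commutator (escale c f) g = escale c (commutator f g)"
    "commutator f (escale c g) = escale c (commutator f g)"
    by (simp_all add: commutator_def endo.scale_right_diff_distrib)
qed


section \<open>The defect of a lift\<close>

lemma calkin_proj_eq_iff: "calkin_proj f = calkin_proj g \<longleftrightarrow> finite_rank (f - g)"
  by (simp add: calkin.abs_eq_iff calkin_rel_def)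

lemma calkin_proj_commutator:
  "calkin_proj (commutator f g) = commutator (calkin_proj f) (calkin_proj g)"
  by (simp add: commutator_def times_calkin.abs_eq minus_calkin.abs_eq)

lemma ring_embedding_commutator:
  assumes "ring_embedding \<theta>"
  shows "\<theta> (commutator x y) = commutator (\<theta> x) (\<theta> y)"
proof -
  have "\<theta> ((a - b) + b) = \<theta> (a - b) + \<theta> b" for a b
    using assms unfolding ring_embedding_def by blast
  then have "\<theta> (a - b) = \<theta> a - \<theta> b" for a b
    by (simp add: eq_diff_eq)
  with assms show ?thesis by (simp add: ring_embedding_def commutator_def)
qed

definition defect ::
    "('k::division_ring \<Rightarrow> 'a::differential_field endo) \<Rightarrow> 'k \<Rightarrow> 'k \<Rightarrow> 'a endo" where
  "defect \<alpha> x y = \<alpha> (commutator x y) - commutator (\<alpha> x) (\<alpha> y)"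

lemma sigma_defect: "sigma \<alpha> x y = trace (defect \<alpha> x y)"
  by (simp add: sigma_def defect_def)

lemma finite_rank_defect:
  assumes "ring_embedding \<theta>" "linear_lift \<iota> \<theta> \<alpha>"
  shows "finite_rank (defect \<alpha> x y)"
proof -
  have "calkin_proj (\<alpha> z) = \<theta> z" for z
    using assms(2) by (simp add: linear_lift_def)
  then show ?thesis
    unfolding defect_def
    by (simp flip: calkin_proj_eq_iff
        add: calkin_proj_commutator ring_embedding_commutator[OF assms(1)])
qed

lemma linear_lift_linear:
  assumes "linear_lift \<iota> \<theta> \<alpha>"
  shows "\<alpha> (x + y) = \<alpha> x + \<alpha> y" "\<alpha> (x - y) = \<alpha> x - \<alpha> y" "\<alpha> (qscale \<iota> c x) = escale c (\<alpha> x)"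
    "\<alpha> 0 = 0"
proof -
  interpret Vector_Spaces.linear "qscale \<iota>" escale \<alpha>
    using assms by (simp add: linear_lift_def)
  show "\<alpha> (x + y) = \<alpha> x + \<alpha> y" "\<alpha> (x - y) = \<alpha> x - \<alpha> y" "\<alpha> (qscale \<iota> c x) = escale c (\<alpha> x)"
    "\<alpha> 0 = 0"
    by (simp_all add: add diff scale zero)
qed

lemma linear_functional_qscale_iff:
  assumes "field_of_quotients \<iota>"
  shows "Vector_Spaces.linear (qscale \<iota>) (*) f \<longleftrightarrow>
    (\<forall>x y. f (x + y) = f x + f y) \<and> (\<forall>c x. f (qscale \<iota> c x) = c * f x)"
proof -
  have "vector_space (qscale \<iota>)"
    using assms vector_space_qscale by (auto simp: field_of_quotients_def)
  moreover have "vector_space ((*) :: 'a constants \<Rightarrow> _)" 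
    by standard (simp_all add: algebra_simps)
  ultimately show ?thesis by (simp add: Vector_Spaces.linear_iff)
qed

lemma sigma_cochain:
  assumes "field_of_quotients \<iota>" "ring_embedding \<theta>" and \<alpha>: "linear_lift \<iota> \<theta> \<alpha>"
  shows "sigma \<alpha> \<in> cochains2 (qscale \<iota>)"
proof -
  note fin = finite_rank_defect[OF assms(2) \<alpha>]
  note lin = linear_lift_linear[OF \<alpha>]
  have "defect \<alpha> (x + y) z = defect \<alpha> x z + defect \<alpha> y z"
    "defect \<alpha> z (x + y) = defect \<alpha> z x + defect \<alpha> z y" for x y z
    by (simp_all add: defect_def lin commutator_add_left commutator_add_right)
  moreover have "defect \<alpha> (qscale \<iota> c x) z = escale c (defect \<alpha> x z)"
    "defect \<alpha> z (qscale \<iota> c x) = escale c (defect \<alpha> z x)" for c x z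
    by (simp_all add: defect_def lin commutator_qscale[OF assms(1)] commutator_escale
        endo.scale_right_diff_distrib)
  moreover have "defect \<alpha> x x = 0" for x
    by (simp add: defect_def commutator_self lin)
  ultimately show ?thesis
    by (simp add: cochains2_def linear_functional_qscale_iff[OF assms(1)] sigma_defect
        trace_add trace_scale fin trace_0)
qed

text \<open>
  Modulo commutators with one factor of finite rank, the alternating sum of the defects
  vanishes by the Jacobi identities for operators and for linear maps.
\<close>

lemma sigma_cocycle:
  assumes "field_of_quotients \<iota>" "ring_embedding \<theta>" and \<alpha>: "linear_lift \<iota> \<theta> \<alpha>"
  shows "sigma \<alpha> \<in> cocycles2 (qscale \<iota>) commutator"
proof -
  note fin = finite_rank_defect[OF assms(2) \<alpha>]
  note lin = linear_lift_linear[OF \<alpha>]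
  have "differential2 commutator (sigma \<alpha>) x y z = 0" for x y z
  proof -
    let ?J = "\<lambda>x y z. commutator (commutator x y) z - commutator (commutator x z) y
      + commutator (commutator y z) x"
    let ?S = "defect \<alpha> (commutator x y) z - defect \<alpha> (commutator x z) y
      + defect \<alpha> (commutator y z) x"
    let ?T = "commutator (defect \<alpha> x y) (\<alpha> z) - commutator (defect \<alpha> x z) (\<alpha> y)
      + commutator (defect \<alpha> y z) (\<alpha> x)"
    have "?S + ?T = \<alpha> (?J x y z) - ?J (\<alpha> x) (\<alpha> y) (\<alpha> z)"
      by (simp add: defect_def lin commutator_diff_left)
    also have "\<dots> = 0"
      by (simp only: commutator_jacobi lin diff_zero)
    finally have "?S = - ?T"
      by (rule eq_neg_iff_add_eq_0[THEN iffD2])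
    then have "trace ?S = trace (- ?T)" by simp
    then show ?thesis
      by (simp add: differential2_def sigma_defect algebra_simps trace_add trace_diff trace_minus fin
          finite_rank_add finite_rank_diff finite_rank_commutator_left trace_commutator_left)
  qed
  with sigma_cochain[OF assms] show ?thesis by (simp add: cocycles2_def)
qed

lemma sigma_cohomologous:
  assumes "field_of_quotients \<iota>" "ring_embedding \<theta>"
    and \<alpha>: "linear_lift \<iota> \<theta> \<alpha>" and \<beta>: "linear_lift \<iota> \<theta> \<beta>"
  shows "(sigma \<alpha>, sigma \<beta>) \<in> cohomologous2 (qscale \<iota>) commutator"
proof -
  define \<phi> where "\<phi> x = \<alpha> x - \<beta> x" for x
  have "calkin_proj (\<alpha> x) = calkin_proj (\<beta> x)" for x
    using \<alpha> \<beta> by (simp add: linear_lift_def)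
  then have \<phi>: "finite_rank (\<phi> x)" for x
    by (simp add: calkin_proj_eq_iff \<phi>_def)
  note fin = finite_rank_defect[OF assms(2) \<alpha>] finite_rank_defect[OF assms(2) \<beta>]
  note lin = linear_lift_linear[OF \<alpha>] linear_lift_linear[OF \<beta>]
  have "\<phi> (x + y) = \<phi> x + \<phi> y" "\<phi> (qscale \<iota> c x) = escale c (\<phi> x)" for c x y
    by (simp_all add: \<phi>_def lin endo.scale_right_diff_distrib)
  then have "(\<lambda>x. - trace (\<phi> x)) \<in> cochains1 (qscale \<iota>)"
    by (simp add: cochains1_def linear_functional_qscale_iff[OF assms(1)] trace_add trace_scale \<phi>)
  moreover have "sigma \<alpha> x y - sigma \<beta> x y = differential1 commutator (\<lambda>x. - trace (\<phi> x)) x y"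
    for x y
  proof -
    have "defect \<alpha> x y - defect \<beta> x y
        = \<phi> (commutator x y) - commutator (\<phi> x) (\<alpha> y) - commutator (\<beta> x) (\<phi> y)"
      by (simp add: defect_def \<phi>_def commutator_diff_left commutator_diff_right)
    then have "trace (defect \<alpha> x y - defect \<beta> x y) =
        trace (\<phi> (commutator x y) - commutator (\<phi> x) (\<alpha> y) - commutator (\<beta> x) (\<phi> y))"
      by simp
    then show ?thesis
      by (simp add: sigma_defect differential1_def trace_diff fin \<phi> finite_rank_diff
          finite_rank_commutator_left finite_rank_commutator_right
          trace_commutator_left trace_commutator_right)
  qed
  ultimately have "(\<lambda>x y. sigma \<alpha> x y - sigma \<beta> x y) \<in> coboundaries2 (qscale \<iota>) commutator"
    unfolding coboundaries2_def by (intro image_eqI) (auto simp: fun_eq_iff)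
  then show ?thesis
    using sigma_cocycle[OF assms(1,2) \<alpha>] sigma_cocycle[OF assms(1,2) \<beta>]
    by (simp add: cohomologous2_def)
qed

lemma H2_class_in_H2_Lie:
  "\<sigma> \<in> cocycles2 s br \<Longrightarrow> H2_class s br \<sigma> \<in> H2_Lie s br"
  by (simp add: H2_class_def H2_Lie_def quotientI)

theorem proposition5p5:
  fixes \<iota> :: "'a::{differential_field, field_char_0} diffop \<Rightarrow> 'k::division_ring"
    and \<theta> :: "'k \<Rightarrow> 'a calkin"
  assumes ldc: "linearly_differentially_closed TYPE('a)"
    and factorization: "\<And>P :: 'a diffop. \<exists>Ps. (\<forall>Q\<in>set Ps. ddegree Q \<le> 1) \<and> P = prod_list Ps"
    and onto: "\<And>P :: 'a diffop. P \<noteq> 0 \<Longrightarrow> surj (diffop_apply P)"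
    and dim_kernel: "\<And>P :: 'a diffop. P \<noteq> 0 \<Longrightarrow> const.dim {a. diffop_apply P a = 0} = ddegree P"
    and C_alg_closed: "\<And>p :: 'a constants poly. degree p > 0 \<Longrightarrow> \<exists>c. poly p c = 0"
    and C_neq_F: "{a :: 'a. deriv a = 0} \<noteq> UNIV"
    and quotients: "field_of_quotients \<iota>"
    and theta_embedding: "ring_embedding \<theta>"
    and theta_extends: "\<And>P. \<theta> (\<iota> P) = calkin_proj (diffop_endo P)"
  shows "(\<forall>\<alpha>. linear_lift \<iota> \<theta> \<alpha> \<longrightarrow> sigma \<alpha> \<in> cocycles2 (qscale \<iota>) commutator) \<and>
    (\<forall>\<alpha> \<beta>. linear_lift \<iota> \<theta> \<alpha> \<longrightarrow> linear_lift \<iota> \<theta> \<beta> \<longrightarrow>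
      H2_class (qscale \<iota>) commutator (sigma \<alpha>) \<in> H2_Lie (qscale \<iota>) commutator \<and>
      H2_class (qscale \<iota>) commutator (sigma \<alpha>) = H2_class (qscale \<iota>) commutator (sigma \<beta>))"
  using sigma_cocycle[OF quotients theta_embedding] H2_class_in_H2_Lie
    H2_class_eqI[OF sigma_cohomologous[OF quotients theta_embedding]]
  by blast

end
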